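(* Let $\Phi=(A;\{E_i\}_{i=0}^d;A^*;\{E_i^*\}_{i=0}^d)$ be a tridiagonal system of diameter $d\geq 1$ on $V$ over $\mathbb{K}$, with first and second split decompositions $\{U_i\}_{i=0}^d$, $\{U_i^{\Downarrow}\}_{i=0}^d$, and let $\Delta\in\mathrm{End}(V)$ be the linear transformation attached to $\Phi$ as defined in the context. Then for $0\le i\le d$ both $$\Delta U_i=U_i^{\Downarrow},\qquad (\Delta-I)U_i\subseteq U_0+U_1+\cdots+U_{i-1}.$$
   Context: $\mathbb{K}$ is a field, $V$ is a $\mathbb{K}$-vector space of finite positive dimension, $\mathrm{End}(V)$ is the algebra of linear maps $V\to V$, and $I$ is the identity. A tridiagonal pair (TD pair) on $V$ is an ordered pair $A,A^*\in\mathrm{End}(V)$ ($A^*$ is just a name, not an adjoint) such that: (i) $A$ and $A^*$ are each diagonalizable over $\mathbb{K}$; (ii) there is an ordering $\{V_i\}_{i=0}^d$ of the eigenspaces of $A$ with $A^*V_i\subseteq V_{i-1}+V_i+V_{i+1}$ for $0\le i\le d$, where $V_{-1}=V_{d+1}=0$; (iii) there is an ordering $\{V_i^*\}_{i=0}^{\delta}$ of the eigenspaces of $A^*$ with $AV_i^*\subseteq V_{i-1}^*+V_i^*+V_{i+1}^*$ for $0\le i\le\delta$, where $V_{-1}^*=V_{\delta+1}^*=0$; (iv) there is no subspace $W$ of $V$ with $AW\subseteq W$, $A^*W\subseteq W$, $W\ne0$, $W\ne V$. It is known that $d=\delta$; this is the diameter, and it is assumed that $d\ge1$. Orderings satisfying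 (ii) (resp. (iii)) are called standard. The primitive idempotent of a diagonalizable map associated with one of its eigenspaces is the projection of $V$ onto that eigenspace that kills the other eigenspaces. A tridiagonal system (TD system) on $V$ is a sequence $\Phi=(A;\{E_i\}_{i=0}^d;A^*;\{E_i^*\}_{i=0}^d)$ where $A,A^*$ is a TD pair on $V$, $\{E_i\}_{i=0}^d$ is an ordering of the primitive idempotents of $A$ such that $\{E_iV\}_{i=0}^d$ is standard, and $\{E_i^*\}_{i=0}^d$ is an ordering of the primitive idempotents of $A^*$ such that $\{E_i^*V\}_{i=0}^d$ is standard. For $0\le i\le d$ set $U_i=(E_0^*V+\cdots+E_i^*V)\cap(E_iV+\cdots+E_dV)$ and $U_i^{\Downarrow}=(E_0^*V+\cdots+E_i^*V)\cap(E_0V+\cdots+E_{d-i}V)$. It is known that $V=\bigoplus_{i=0}^dU_i=\bigoplus_{i=0}^dU_i^{\Downarrow}$ (first and second split decompositions). Let $F_i$ be the projection of $V$ onto $U_i$ along $\bigoplus_{j\ne i}U_j$, and $F_i^{\Downarrow}$ the projection of $V$ onto $U_i^{\Downarrow}$ along $\bigoplus_{j\ne i}U_j^{\Downarrow}$. Define $\Delta=\sum_{h=0}^dF_h^{\Downarrow}F_h$. An empty sum of subspaces is $0$. *)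

theory Defs
  imports Complex_Main "HOL-Library.Set_Algebras"
begin

text \<open>
  The vector space \<open>V\<close> is the universe of the type \<open>'v\<close>, with scalar multiplication \<open>scale\<close>.
  Sums of subspaces are the pointwise sums of \<^theory>\<open>HOL-Library.Set_Algebras\<close>, both for the binary \<open>+\<close>
  and for the indexed \<open>\<Sum>\<close>; the empty sum is \<open>{0}\<close>.
\<close>

definition eigenspaces :: "('k::field \<Rightarrow> 'v::ab_group_add \<Rightarrow> 'v) \<Rightarrow> ('v \<Rightarrow> 'v) \<Rightarrow> 'v set set" where
  "eigenspaces scale A = {W. W \<noteq> {0} \<and> (\<exists>\<theta>. W = {v. A v = scale \<theta> v})}"

definition diagonalizable :: "('k::field \<Rightarrow> 'v::ab_group_add \<Rightarrow> 'v) \<Rightarrow> ('v \<Rightarrow> 'v) \<Rightarrow> bool" where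
  "diagonalizable scale A \<longleftrightarrow> module.span scale (\<Union>(eigenspaces scale A)) = UNIV"

text \<open>\<open>W 0, \<dots>, W d\<close> lists each eigenspace of \<open>A\<close> exactly once, and \<open>B\<close> acts tridiagonally on it;
  the terms of index \<open>-1\<close> and \<open>d + 1\<close> are \<open>{0}\<close>.\<close>

definition standard_ordering ::
  "('k::field \<Rightarrow> 'v::ab_group_add \<Rightarrow> 'v) \<Rightarrow> ('v \<Rightarrow> 'v) \<Rightarrow> ('v \<Rightarrow> 'v) \<Rightarrow> nat \<Rightarrow> (nat \<Rightarrow> 'v set) \<Rightarrow> bool" where
  "standard_ordering scale A B d W \<longleftrightarrow>
     bij_betw W {..d} (eigenspaces scale A) \<and>
     (\<forall>i\<le>d. B ` W i \<subseteq>
        (if i = 0 then {0} else W (i - 1)) + W i + (if i = d then {0} else W (i + 1)))"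

definition tridiagonal_pair ::
  "('k::field \<Rightarrow> 'v::ab_group_add \<Rightarrow> 'v) \<Rightarrow> ('v \<Rightarrow> 'v) \<Rightarrow> ('v \<Rightarrow> 'v) \<Rightarrow> bool" where
  "tridiagonal_pair scale A As \<longleftrightarrow>
     Vector_Spaces.linear scale scale A \<and> Vector_Spaces.linear scale scale As \<and>
     diagonalizable scale A \<and> diagonalizable scale As \<and>
     (\<exists>d W. standard_ordering scale A As d W) \<and>
     (\<exists>\<delta> Ws. standard_ordering scale As A \<delta> Ws) \<and>
     \<not> (\<exists>W. module.subspace scale W \<and> A ` W \<subseteq> W \<and> As ` W \<subseteq> W \<and> W \<noteq> {0} \<and> W \<noteq> UNIV)"

definition primitive_idempotents ::
  "('k::field \<Rightarrow> 'v::ab_group_add \<Rightarrow> 'v) \<Rightarrow> ('v \<Rightarrow> 'v) \<Rightarrow> ('v \<Rightarrow> 'v) set" where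
  "primitive_idempotents scale A =
     {E. Vector_Spaces.linear scale scale E \<and>
         (\<exists>W\<in>eigenspaces scale A. range E = W \<and> (\<forall>v\<in>W. E v = v) \<and>
            (\<forall>W'\<in>eigenspaces scale A - {W}. \<forall>v\<in>W'. E v = 0))}"

definition tridiagonal_system ::
  "('k::field \<Rightarrow> 'v::ab_group_add \<Rightarrow> 'v) \<Rightarrow> nat \<Rightarrow>
     ('v \<Rightarrow> 'v) \<Rightarrow> (nat \<Rightarrow> 'v \<Rightarrow> 'v) \<Rightarrow> ('v \<Rightarrow> 'v) \<Rightarrow> (nat \<Rightarrow> 'v \<Rightarrow> 'v) \<Rightarrow> bool" where
  "tridiagonal_system scale d A E As Es \<longleftrightarrow>
     tridiagonal_pair scale A As \<and>
     bij_betw E {..d} (primitive_idempotents scale A) \<and>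
     standard_ordering scale A As d (\<lambda>i. range (E i)) \<and>
     bij_betw Es {..d} (primitive_idempotents scale As) \<and>
     standard_ordering scale As A d (\<lambda>i. range (Es i))"

definition split_U :: "nat \<Rightarrow> (nat \<Rightarrow> 'v \<Rightarrow> 'v) \<Rightarrow> (nat \<Rightarrow> 'v \<Rightarrow> 'v) \<Rightarrow> nat \<Rightarrow> 'v::ab_group_add set" where
  "split_U d E Es i = (\<Sum>h\<in>{..i}. range (Es h)) \<inter> (\<Sum>h\<in>{i..d}. range (E h))"

definition split_U_down :: "nat \<Rightarrow> (nat \<Rightarrow> 'v \<Rightarrow> 'v) \<Rightarrow> (nat \<Rightarrow> 'v \<Rightarrow> 'v) \<Rightarrow> nat \<Rightarrow> 'v::ab_group_add set" where
  "split_U_down d E Es i = (\<Sum>h\<in>{..i}. range (Es h)) \<inter> (\<Sum>h\<in>{..d - i}. range (E h))"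

text \<open>The projection onto \<open>P\<close> along \<open>Q\<close>; meaningful when the whole space is the direct sum of
  the subspaces \<open>P\<close> and \<open>Q\<close>, in which case \<open>p\<close> exists uniquely.\<close>

definition projection_along :: "'v::ab_group_add set \<Rightarrow> 'v set \<Rightarrow> 'v \<Rightarrow> 'v" where
  "projection_along P Q v = (THE p. p \<in> P \<and> v - p \<in> Q)"

definition split_F :: "nat \<Rightarrow> (nat \<Rightarrow> 'v \<Rightarrow> 'v) \<Rightarrow> (nat \<Rightarrow> 'v \<Rightarrow> 'v) \<Rightarrow> nat \<Rightarrow> 'v::ab_group_add \<Rightarrow> 'v" where
  "split_F d E Es i =
     projection_along (split_U d E Es i) (\<Sum>j\<in>{..d} - {i}. split_U d E Es j)"

definition split_F_down :: "nat \<Rightarrow> (nat \<Rightarrow> 'v \<Rightarrow> 'v) \<Rightarrow> (nat \<Rightarrow> 'v \<Rightarrow> 'v) \<Rightarrow> nat \<Rightarrow> 'v::ab_group_add \<Rightarrow> 'v" where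
  "split_F_down d E Es i =
     projection_along (split_U_down d E Es i) (\<Sum>j\<in>{..d} - {i}. split_U_down d E Es j)"

definition split_Delta :: "nat \<Rightarrow> (nat \<Rightarrow> 'v \<Rightarrow> 'v) \<Rightarrow> (nat \<Rightarrow> 'v \<Rightarrow> 'v) \<Rightarrow> 'v::ab_group_add \<Rightarrow> 'v" where
  "split_Delta d E Es v = (\<Sum>h\<in>{..d}. split_F_down d E Es h (split_F d E Es h v))"

end

theory Submission
  imports Defs
begin

text \<open>
  Write \<open>V\<^sub>h\<close> and \<open>V\<^sub>h\<^sup>*\<close> for the eigenspaces of \<open>A\<close> and \<open>A\<^sup>*\<close>, and let
  \<open>X\<^sub>i = V\<^sub>0\<^sup>* + \<dots> + V\<^sub>i\<^sub>-\<^sub>1\<^sup>*\<close>. The theorem rests on the fact that both split decompositions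
  have the same partial sums, namely the members of this flag:
  \<open>U\<^sub>0 + \<dots> + U\<^sub>i\<^sub>-\<^sub>1 = X\<^sub>i = D\<^sub>0 + \<dots> + D\<^sub>i\<^sub>-\<^sub>1\<close>, where \<open>D\<^sub>i\<close> denotes the second
  decomposition. So \<open>U\<^sub>i\<close> and \<open>D\<^sub>i\<close> are two complements of \<open>X\<^sub>i\<close> in \<open>X\<^sub>i\<^sub>+\<^sub>1\<close>. On \<open>U\<^sub>i\<close>, the map
  \<open>\<Delta>\<close> is just the projection to \<open>D\<^sub>i\<close>. It sends \<open>u\<close> to the unique element of \<open>D\<^sub>i\<close> congruent to \<open>u\<close>
  modulo \<open>X\<^sub>i\<close>; hence it maps \<open>U\<^sub>i\<close> onto \<open>D\<^sub>i\<close>, and \<open>\<Delta> - I\<close> maps \<open>U\<^sub>i\<close> into \<open>X\<^sub>i\<close>. This is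
  \<open>sum_of_projections_between_decompositions\<close>.

  The partial sums are computed in \<open>split_decomposition\<close>, which intersects the flag \<open>X\<close> with a flag
  \<open>Y\<close> of sums of eigenspaces of \<open>A\<close>. By the tridiagonal relations, sums of suitable
  intersections are invariant under \<open>A\<close> and \<open>A\<^sup>*\<close>, so irreducibility leaves only \<open>0\<close> and the whole
  space. One such sum forces the two flags to be opposite, \<open>X\<^sub>i \<inter> Y\<^sub>d\<^sub>+\<^sub>1\<^sub>-\<^sub>i = 0\<close>, and another
  shows that the pieces \<open>X\<^sub>i\<^sub>+\<^sub>1 \<inter> Y\<^sub>d\<^sub>+\<^sub>1\<^sub>-\<^sub>i\<close> span.
  Summing the \<open>V\<^sub>h\<close> in the given order yields the second split decomposition; the reversed order
  is standard as well and yields the first.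
\<close>


section \<open>Sums of subspaces\<close>

context vector_space
begin

lemma subspace_set_sum:
  assumes "finite I" "\<And>i. i \<in> I \<Longrightarrow> subspace (S i)"
  shows "subspace (\<Sum>i\<in>I. S i)"
  using assms
proof (induction I rule: finite_induct)
  case empty
  then show ?case by (simp add: set_zero subspace_single_0)
next
  case (insert j I)
  have "S j + (\<Sum>i\<in>I. S i) = {x + y | x y. x \<in> S j \<and> y \<in> (\<Sum>i\<in>I. S i)}"
    by (auto simp: set_plus_def)
  with insert show ?case
    by (simp add: subspace_sums)
qed

lemma set_sum_least:
  assumes "finite I" "subspace W" "\<And>i. i \<in> I \<Longrightarrow> S i \<subseteq> W"
  shows "(\<Sum>i\<in>I. S i) \<subseteq> W"
  using assms by (auto simp: set_sum_alt intro!: subspace_sum)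

lemma set_sum_upper:
  assumes "finite I" "\<And>i. i \<in> I \<Longrightarrow> subspace (S i)" "i \<in> I"
  shows "S i \<subseteq> (\<Sum>i\<in>I. S i)"
proof -
  have "S i + {0} \<subseteq> S i + (\<Sum>j\<in>I - {i}. S j)"
    using assms by (intro set_plus_mono2) (auto intro!: subspace_0 subspace_set_sum)
  then show ?thesis
    by (simp add: sum.remove[OF assms(1,3), of S])
qed

lemma set_sum_mono_index:
  assumes "finite J" "I \<subseteq> J" "\<And>i. i \<in> J \<Longrightarrow> subspace (S i)"
  shows "(\<Sum>i\<in>I. S i) \<subseteq> (\<Sum>i\<in>J. S i)"
proof (rule set_sum_least)
  show "subspace (\<Sum>i\<in>J. S i)"
    using assms(1,3) by (rule subspace_set_sum)
  show "S i \<subseteq> (\<Sum>i\<in>J. S i)" if "i \<in> I" for i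
    using assms that by (intro set_sum_upper) auto
qed (use assms finite_subset in blast)

lemma linear_image_set_sum:
  assumes "Vector_Spaces.linear scale scale L" "finite I" "subspace W"
    and "\<And>i v. i \<in> I \<Longrightarrow> v \<in> S i \<Longrightarrow> L v \<in> W" and "v \<in> (\<Sum>i\<in>I. S i)"
  shows "L v \<in> W"
proof -
  interpret L: Vector_Spaces.linear scale scale L by fact
  from assms(2,5) obtain s where "v = sum s I" "\<forall>i\<in>I. s i \<in> S i"
    by (auto simp: set_sum_alt)
  then show ?thesis
    using assms by (auto simp: L.sum intro!: subspace_sum)
qed

lemma invariant_under_shift:
  assumes "subspace W" "v \<in> W" "B v - scale c v \<in> W"
  shows "B v \<in> W"
  using subspace_add[OF assms(1,3) subspace_scale[OF assms(1,2), of c]] by simp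


section \<open>Two decompositions adapted to one flag\<close>

text \<open>A vanishing sum is resolved from the top index downwards: its last term is minus the sum of
  the earlier ones.\<close>

lemma triangular_sum_eq_0:
  fixes n :: nat
  assumes "\<And>i. i < n \<Longrightarrow> subspace (U i)"
    and "\<And>i. i < n \<Longrightarrow> U i \<inter> (\<Sum>j<i. U j) = {0}"
    and "\<And>i. i < n \<Longrightarrow> f i \<in> U i" and "(\<Sum>i<n. f i) = 0" and "i < n"
  shows "f i = 0"
  using assms
proof (induction n arbitrary: i)
  case (Suc n)
  have "(\<Sum>i<n. f i) \<in> (\<Sum>i<n. U i)"
    using Suc.prems(3) by (auto simp: set_sum_alt)
  then have "- (\<Sum>i<n. f i) \<in> (\<Sum>i<n. U i)"
    using Suc.prems(1) by (intro subspace_neg subspace_set_sum) auto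
  moreover have "f n = - (\<Sum>i<n. f i)"
    using Suc.prems(4) by (simp add: eq_neg_iff_add_eq_0 add.commute)
  ultimately have "f n \<in> U n \<inter> (\<Sum>i<n. U i)"
    using Suc.prems(3)[OF lessI] by (metis IntI)
  then have n: "f n = 0"
    unfolding Suc.prems(2)[OF lessI] by simp
  have "f i = 0" if "i < n"
  proof (rule Suc.IH)
    show "U j \<inter> (\<Sum>k<j. U k) = {0}" if "j < n" for j
      using that by (intro Suc.prems(2) less_SucI)
    show "(\<Sum>i<n. f i) = 0"
      using Suc.prems(4) n by simp
  qed (use Suc.prems(1,3) that in simp_all)
  with n Suc.prems(5) show ?case
    using less_Suc_eq by blast
qed simp

text \<open>The difference of two candidates for the projection lies in both summands, hence completes to
  a vanishing sum over all indices.\<close>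

lemma projection_along_eq:
  fixes d :: nat
  assumes U: "\<And>i. i \<le> d \<Longrightarrow> subspace (U i)"
    and triangular: "\<And>i. i \<le> d \<Longrightarrow> U i \<inter> (\<Sum>j<i. U j) = {0}"
    and i: "i \<le> d" and p: "p \<in> U i" and q: "v - p \<in> (\<Sum>j\<in>{..d} - {i}. U j)"
  shows "projection_along (U i) (\<Sum>j\<in>{..d} - {i}. U j) v = p"
  unfolding projection_along_def
proof (rule the_equality)
  fix p' assume p': "p' \<in> U i \<and> v - p' \<in> (\<Sum>j\<in>{..d} - {i}. U j)"
  let ?Q = "\<Sum>j\<in>{..d} - {i}. U j"
  have "subspace ?Q"
    using U by (intro subspace_set_sum) auto
  from subspace_diff[OF this q] p' have "p' - p \<in> ?Q"
    by fastforce
  then obtain f where f: "p' - p = (\<Sum>j\<in>{..d} - {i}. f j)" "\<forall>j\<in>{..d} - {i}. f j \<in> U j"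
    by (auto simp: set_sum_alt)
  define g where "g = f(i := p - p')"
  have "(\<Sum>j<Suc d. g j) = g i + (\<Sum>j\<in>{..d} - {i}. g j)"
    using i by (simp add: lessThan_Suc_atMost sum.remove)
  also have "(\<Sum>j\<in>{..d} - {i}. g j) = (\<Sum>j\<in>{..d} - {i}. f j)"
    by (intro sum.cong) (auto simp: g_def)
  finally have "(\<Sum>j<Suc d. g j) = 0"
    by (simp add: g_def flip: f(1))
  moreover have "g j \<in> U j" if "j < Suc d" for j
    using that f(2) i p p' U by (auto simp: g_def intro: subspace_diff)
  ultimately have "g i = 0"
    using U triangular i by (intro triangular_sum_eq_0[of "Suc d" U g]) auto
  then show "p' = p"
    by (simp add: g_def)
qed (use p q in auto)

text \<open>When \<open>U\<close> and \<open>D\<close> have the same partial sums, \<open>U i\<close> and \<open>D i\<close> are two complements of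
  the same subspace inside a larger one. On \<open>U i\<close> only the term \<open>h = i\<close> of the sum survives, so the
  map there is the canonical identification of the two complements, which moves every vector by an
  element of the subspace that they complement.\<close>

lemma sum_of_projections_between_decompositions:
  fixes d :: nat and U D :: "nat \<Rightarrow> 'b set"
  defines "F \<equiv> \<lambda>i. projection_along (U i) (\<Sum>j\<in>{..d} - {i}. U j)"
    and "G \<equiv> \<lambda>i. projection_along (D i) (\<Sum>j\<in>{..d} - {i}. D j)"
  defines "\<Delta> \<equiv> \<lambda>v. \<Sum>h\<in>{..d}. G h (F h v)"
  assumes U: "\<And>i. i \<le> d \<Longrightarrow> subspace (U i)" and D: "\<And>i. i \<le> d \<Longrightarrow> subspace (D i)"
    and U_tri: "\<And>i. i \<le> d \<Longrightarrow> U i \<inter> (\<Sum>j<i. U j) = {0}"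
    and D_tri: "\<And>i. i \<le> d \<Longrightarrow> D i \<inter> (\<Sum>j<i. D j) = {0}"
    and flag: "\<And>i. i \<le> Suc d \<Longrightarrow> (\<Sum>j<i. U j) = (\<Sum>j<i. D j)"
    and i: "i \<le> d"
  shows "\<Delta> ` U i = D i" and "(\<lambda>v. \<Delta> v - v) ` U i \<subseteq> (\<Sum>j<i. U j)"
proof -
  let ?X = "\<Sum>j<i. U j"
  have X: "subspace ?X"
    using U i by (intro subspace_set_sum) auto
  have F_eq: "F h u = (if h = i then u else 0)" if "u \<in> U i" "h \<le> d" for h u
    unfolding F_def
  proof (rule projection_along_eq)
    let ?Q = "\<Sum>j\<in>{..d} - {h}. U j"
    have "0 \<in> ?Q"
      using U by (intro subspace_0 subspace_set_sum) auto
    moreover have "U i \<subseteq> ?Q" if "h \<noteq> i"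
      using that i U by (intro set_sum_upper) auto
    ultimately show "u - (if h = i then u else 0) \<in> ?Q"
      using that(1) by auto
  qed (use that U U_tri in \<open>simp_all add: subspace_0\<close>)
  have G_eq: "G i v = w" if "w \<in> D i" "v - w \<in> ?X" for v w
    unfolding G_def
  proof (rule projection_along_eq)
    have "(\<Sum>j<i. D j) \<subseteq> (\<Sum>j\<in>{..d} - {i}. D j)"
      using i D by (intro set_sum_mono_index) auto
    then have "?X \<subseteq> (\<Sum>j\<in>{..d} - {i}. D j)"
      using flag[of i] i by simp
    with that show "v - w \<in> (\<Sum>j\<in>{..d} - {i}. D j)"
      by blast
  qed (use that D D_tri i in simp_all)
  have G_0: "G h 0 = 0" if "h \<le> d" for h
    unfolding G_def
  proof (rule projection_along_eq)
    show "0 - 0 \<in> (\<Sum>j\<in>{..d} - {h}. D j)"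
      using D by (auto intro!: subspace_0 subspace_set_sum)
  qed (use that D D_tri in \<open>simp_all add: subspace_0\<close>)
  have Delta_eq: "\<Delta> u = w" if "u \<in> U i" "w \<in> D i" "u - w \<in> ?X" for u w
  proof -
    have "\<Delta> u = (\<Sum>h\<in>{..d}. if h = i then G i u else 0)"
      unfolding \<Delta>_def using that by (intro sum.cong) (auto simp: F_eq G_0)
    also have "\<dots> = w"
      using G_eq[OF that(2,3)] i by simp
    finally show ?thesis .
  qed
  have sums: "?X + U i = ?X + D i"
    using flag[of "Suc i"] flag[of i] i by (simp add: add.commute)
  have U_to_D: "\<exists>w\<in>D i. u - w \<in> ?X" if "u \<in> U i" for u
  proof -
    have "0 + u \<in> ?X + D i"
      using set_plus_intro[OF subspace_0[OF X] that] sums by simp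
    then obtain x w where "x \<in> ?X" "w \<in> D i" "u = x + w"
      by (auto elim!: set_plus_elim)
    then show ?thesis
      by (intro bexI[of _ w]) auto
  qed
  have D_to_U: "\<exists>u\<in>U i. u - w \<in> ?X" if "w \<in> D i" for w
  proof -
    have "0 + w \<in> ?X + U i"
      using set_plus_intro[OF subspace_0[OF X] that] sums by simp
    then obtain x u where "x \<in> ?X" "u \<in> U i" "w = x + u"
      by (auto elim!: set_plus_elim)
    then show ?thesis
      using subspace_neg[OF X] by (intro bexI[of _ u]) auto
  qed
  show "\<Delta> ` U i = D i"
  proof (intro equalityI subsetI)
    fix w assume "w \<in> \<Delta> ` U i"
    then show "w \<in> D i"
      using U_to_D Delta_eq by fastforce
  next
    fix w assume w: "w \<in> D i"
    from D_to_U[OF this] obtain u where "u \<in> U i" "u - w \<in> ?X" by blast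
    with Delta_eq[OF _ w] show "w \<in> \<Delta> ` U i" by blast
  qed
  show "(\<lambda>v. \<Delta> v - v) ` U i \<subseteq> ?X"
  proof (intro image_subsetI)
    fix u assume u: "u \<in> U i"
    from U_to_D[OF this] obtain w where w: "w \<in> D i" "u - w \<in> ?X" by blast
    have "- (u - w) \<in> ?X"
      using subspace_neg[OF X w(2)] .
    then show "\<Delta> u - u \<in> ?X"
      using Delta_eq[OF u w] by simp
  qed
qed

end


section \<open>Flags of eigenspaces\<close>

text \<open>The model is a standard ordering of the eigenspaces of \<open>A\<close>, with \<open>\<theta>\<close> the eigenvalues and
  \<open>X i\<close> the sum of the first \<open>i\<close> eigenspaces: \<open>A - \<theta> i\<close> lowers the flag by one step, and the other
  map \<open>B\<close> raises it by at most one. Indexing by the number of summands puts \<open>{0}\<close> and the whole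
  space at the two ends, which removes the special cases of tridiagonality at the ends.\<close>

definition adapted_flag ::
  "('k::field \<Rightarrow> 'v::ab_group_add \<Rightarrow> 'v) \<Rightarrow> ('v \<Rightarrow> 'v) \<Rightarrow> ('v \<Rightarrow> 'v) \<Rightarrow> nat \<Rightarrow> (nat \<Rightarrow> 'k) \<Rightarrow>
     (nat \<Rightarrow> 'v set) \<Rightarrow> bool" where
  "adapted_flag scale A B d \<theta> X \<longleftrightarrow>
     (\<forall>i\<le>Suc d. module.subspace scale (X i)) \<and> (\<forall>i\<le>d. X i \<subseteq> X (Suc i)) \<and>
     X 0 = {0} \<and> X (Suc d) = UNIV \<and> X (Suc 0) \<noteq> {0} \<and> X d \<noteq> UNIV \<and>
     (\<forall>i\<le>d. \<forall>v\<in>X (Suc i). A v - scale (\<theta> i) v \<in> X i) \<and>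
     (\<forall>i\<le>d. \<forall>v\<in>X i. B v \<in> X (Suc i))"

context vector_space
begin

lemma adapted_flag_mono:
  assumes "adapted_flag scale A B d \<theta> X" "i \<le> j" "j \<le> Suc d"
  shows "X i \<subseteq> X j"
  using assms(2,3)
proof (induction j rule: dec_induct)
  case (step n)
  then show ?case
    using assms(1) by (force simp: adapted_flag_def)
qed simp

lemma subspace_eigenspace:
  assumes "Vector_Spaces.linear scale scale A"
  shows "subspace {v. A v = scale c v}"
proof -
  interpret A: Vector_Spaces.linear scale scale A by fact
  show ?thesis
    by (auto simp: subspace_def A.add A.scale A.zero scale_right_distrib scale_left_commute)
qed

text \<open>The lowering property holds because \<open>A - \<theta> i\<close> kills the last summand of \<open>X (Suc i)\<close> and
  preserves the others; the raising property is tridiagonality. That \<open>X d\<close> is proper expresses the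
  independence of eigenspaces.\<close>

lemma adapted_flag_standard_ordering:
  assumes A: "Vector_Spaces.linear scale scale A" and B: "Vector_Spaces.linear scale scale B"
    and diag: "diagonalizable scale A" and std: "standard_ordering scale A B d V"
  obtains \<theta> where "adapted_flag scale A B d \<theta> (\<lambda>i. \<Sum>h<i. V h)"
proof -
  define X where "X = (\<lambda>i. \<Sum>h<i. V h)"
  have bij: "bij_betw V {..d} (eigenspaces scale A)"
    using std by (simp add: standard_ordering_def)
  then have eig: "V i \<in> eigenspaces scale A" if "i \<le> d" for i
    using that by (auto simp: bij_betw_def)
  then have "\<forall>i\<in>{..d}. \<exists>c. V i = {v. A v = scale c v}"
    by (auto simp: eigenspaces_def)
  then obtain \<theta> where \<theta>: "\<And>i. i \<le> d \<Longrightarrow> V i = {v. A v = scale (\<theta> i) v}"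
    by (metis atMost_iff)
  have subV: "subspace (V i)" if "i \<le> d" for i
    using \<theta>[OF that] subspace_eigenspace[OF A] by simp
  have nonzero: "V i \<noteq> {0}" if "i \<le> d" for i
    using eig[OF that] by (simp add: eigenspaces_def)
  have subX: "subspace (X i)" if "i \<le> Suc d" for i
    unfolding X_def using that subV by (intro subspace_set_sum) auto
  have V_le: "V h \<subseteq> X i" if "h < i" "i \<le> Suc d" for h i
    unfolding X_def using that subV by (intro set_sum_upper) auto
  have mono: "X i \<subseteq> X j" if "i \<le> j" "j \<le> Suc d" for i j
    unfolding X_def using that subV by (intro set_sum_mono_index) auto
  have X0: "X 0 = {0}"
    by (simp add: X_def set_zero)
  have full: "X (Suc d) = UNIV"
  proof -
    have "eigenspaces scale A = V ` {..d}"
      using bij by (simp add: bij_betw_def)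
    then have "\<Union>(eigenspaces scale A) \<subseteq> X (Suc d)"
      using V_le[of _ "Suc d"] by (auto simp: less_Suc_eq_le)
    from span_minimal[OF this subX] diag show ?thesis
      by (auto simp: diagonalizable_def)
  qed
  have lower: "A v - scale (\<theta> i) v \<in> X i" if i: "i \<le> d" and v: "v \<in> X (Suc i)" for i v
  proof -
    interpret A: Vector_Spaces.linear scale scale A by fact
    have lin: "Vector_Spaces.linear scale scale (\<lambda>v. A v - scale (\<theta> i) v)"
      by unfold_locales (auto simp: A.add A.scale algebra_simps)
    show ?thesis
    proof (rule linear_image_set_sum[OF lin, where I = "{..<Suc i}" and S = V])
      fix h w assume h: "h \<in> {..<Suc i}" and w: "w \<in> V h"
      have A_w: "A w - scale (\<theta> i) w = scale (\<theta> h - \<theta> i) w"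
        using w \<theta>[of h] h i by (auto simp: scale_left_diff_distrib)
      show "A w - scale (\<theta> i) w \<in> X i"
      proof (cases "h = i")
        case True
        then show ?thesis
          using A_w subX[of i] i by (auto intro: subspace_0)
      next
        case False
        then have "w \<in> X i"
          using V_le[of h i] h w i by auto
        then show ?thesis
          unfolding A_w using subX[of i] i by (auto intro: subspace_scale)
      qed
    qed (use v i subX in \<open>auto simp: X_def\<close>)
  qed
  have raise: "B v \<in> X (Suc i)" if i: "i \<le> d" and v: "v \<in> X i" for i v
  proof (rule linear_image_set_sum[OF B, where I = "{..<i}" and S = V])
    fix h w assume h: "h \<in> {..<i}" and w: "w \<in> V h"
    let ?P = "if h = 0 then {0} else V (h - 1)" and ?N = "if h = d then {0} else V (h + 1)"
    have "B w \<in> ?P + V h + ?N"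
      using std h w i unfolding standard_ordering_def
      by (meson image_subset_iff le_trans lessThan_iff less_imp_le)
    then obtain a b c where abc: "B w = a + b + c" "a \<in> ?P" "b \<in> V h" "c \<in> ?N"
      by (elim set_plus_elim) blast
    have S: "subspace (X (Suc i))"
      using subX i by simp
    have "a \<in> X (Suc i)" "b \<in> X (Suc i)" "c \<in> X (Suc i)"
      using abc(2-4) h i subspace_0[OF S] V_le[of "h - 1" "Suc i"] V_le[of h "Suc i"]
        V_le[of "h + 1" "Suc i"] less_imp_diff_less[of h "Suc i" 1]
      by (auto split: if_splits)
    then show "B w \<in> X (Suc i)"
      unfolding abc(1) by (intro subspace_add[OF S])
  qed (use v i subX[of "Suc i"] in \<open>auto simp: X_def simp del: sum.lessThan_Suc\<close>)
  have proper: "X d \<noteq> UNIV"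
  proof
    assume all: "X d = UNIV"
    obtain v where v: "v \<in> V d" "v \<noteq> 0"
      using nonzero[of d] subspace_0[OF subV[of d]] by auto
    \<comment> \<open>On \<open>v\<close> the lowering maps are multiplications by the nonzero scalars \<open>\<theta> d - \<theta> i\<close>,
      so \<open>v\<close> cannot leave the flag on its way down to \<open>X 0\<close>.\<close>
    have "v \<in> X 0"
    proof (rule inc_induct[of 0 d "\<lambda>i. v \<in> X i"])
      fix i assume i: "i < d" "v \<in> X (Suc i)"
      have "V i \<noteq> V d"
        using inj_onD[OF bij_betw_imp_inj_on[OF bij], of i d] i(1) by auto
      then have ne: "\<theta> d - \<theta> i \<noteq> 0"
        using \<theta>[of i] \<theta>[of d] i(1) by auto
      have "scale (\<theta> d - \<theta> i) v \<in> X i"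
        using lower[of i v] i v(1) \<theta>[of d] by (auto simp: scale_left_diff_distrib)
      from subspace_scale[OF subX this, of "inverse (\<theta> d - \<theta> i)"] i(1)
      have "scale (inverse (\<theta> d - \<theta> i)) (scale (\<theta> d - \<theta> i) v) \<in> X i"
        by (meson le_SucI less_imp_le)
      then show "v \<in> X i"
        by (simp only: scale_scale left_inverse[OF ne] scale_one)
    qed (use all in auto)
    with X0 v(2) show False by simp
  qed
  have "X (Suc 0) \<noteq> {0}"
    using nonzero[of 0] by (simp add: X_def)
  then have "adapted_flag scale A B d \<theta> X"
    unfolding adapted_flag_def using subX mono X0 full proper lower raise by auto
  then show thesis
    by (intro that[of \<theta>]) (simp add: X_def)
qed

end

text \<open>This symmetry exchanges the two split decompositions, so that only one of them has to be
  constructed.\<close>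

lemma standard_ordering_reverse:
  assumes "standard_ordering scale A B d V"
  shows "standard_ordering scale A B d (\<lambda>i. V (d - i))"
proof -
  have "bij_betw (\<lambda>i. d - i) {..d} {..d}"
    by (rule bij_betw_byWitness[where f' = "\<lambda>i. d - i"]) auto
  from bij_betw_trans[OF this] assms
  have bij: "bij_betw (\<lambda>i. V (d - i)) {..d} (eigenspaces scale A)"
    by (auto simp: standard_ordering_def comp_def)
  have "B ` V (d - i) \<subseteq>
      (if i = 0 then {0} else V (d - (i - 1))) + V (d - i) + (if i = d then {0} else V (d - (i + 1)))"
    if i: "i \<le> d" for i
  proof -
    let ?P = "if d - i = 0 then {0} else V (d - i - 1)"
    let ?N = "if d - i = d then {0} else V (d - i + 1)"
    have "\<forall>j\<le>d. B ` V j \<subseteq>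
        (if j = 0 then {0} else V (j - 1)) + V j + (if j = d then {0} else V (j + 1))"
      using assms unfolding standard_ordering_def by (rule conjunct2)
    from this[rule_format, OF diff_le_self]
    have "B ` V (d - i) \<subseteq> ?P + V (d - i) + ?N" .
    also have "\<dots> = ?N + V (d - i) + ?P"
      by (simp only: ac_simps)
    also have "?N = (if i = 0 then {0} else V (d - (i - 1)))"
      using i by (auto simp: Suc_diff_le[symmetric] intro!: arg_cong[where f = V])
    also have "?P = (if i = d then {0} else V (d - (i + 1)))"
      using i by auto
    finally show ?thesis .
  qed
  with bij show ?thesis
    by (simp add: standard_ordering_def)
qed


section \<open>The split decomposition\<close>

context vector_space
begin

text \<open>For each \<open>r\<close>, the intersections \<open>X (Suc i) \<inter> Y (Suc d - (i + r))\<close> form a ladder: a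
  scalar translate of \<open>A\<close> sends each one into the next, a scalar translate of \<open>As\<close> sends it into the
  previous one, and both vanish where the ladder ends. Hence the sum of its rungs is invariant under
  both maps.\<close>

lemma ladder_sum_invariant:
  assumes X: "adapted_flag scale As A d \<theta>s X" and Y: "adapted_flag scale A As d \<theta> Y"
    and lin: "Vector_Spaces.linear scale scale A" "Vector_Spaces.linear scale scale As"
  defines "W \<equiv> \<lambda>r. \<Sum>i<Suc d - r. X (Suc i) \<inter> Y (Suc d - (i + r))"
  shows "subspace (W r)" "A ` W r \<subseteq> W r" "As ` W r \<subseteq> W r"
proof -
  let ?L = "\<lambda>i. X (Suc i) \<inter> Y (Suc d - (i + r))"
  have sub: "subspace (?L i)" if "i < Suc d - r" for i
    using X Y that by (intro subspace_inter) (auto simp: adapted_flag_def)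
  show W: "subspace (W r)"
    unfolding W_def using sub by (intro subspace_set_sum) auto
  have L_W: "?L i \<subseteq> W r" if "i < Suc d - r" for i
    unfolding W_def using sub that by (intro set_sum_upper) auto
  have A_L: "A v \<in> W r" if i: "i < Suc d - r" and v: "v \<in> ?L i" for i v
  proof -
    have vW: "v \<in> W r"
      using L_W[OF i] v by blast
    \<comment> \<open>The rung lies in \<open>Y (Suc n)\<close>, which \<open>A - \<theta> n\<close> lowers; \<open>n\<close> rungs remain above it.\<close>
    obtain n where n: "d = i + r + n"
      using i by (metis less_diff_conv less_eq_Suc_le nat_le_iff_add Suc_le_mono)
    let ?v = "A v - scale (\<theta> n) v"
    have vX: "v \<in> X (Suc i)" and vY: "v \<in> Y (Suc n)"
      using v n by (auto simp: Suc_diff_le)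
    have Yv: "?v \<in> Y n"
      using Y vY n by (auto simp: adapted_flag_def)
    have "?v \<in> W r"
    proof (cases n)
      case 0
      then show ?thesis
        using Yv Y subspace_0[OF W] by (simp add: adapted_flag_def)
    next
      case (Suc m)
      have S: "subspace (X (Suc (Suc i)))"
        using X Suc n by (auto simp: adapted_flag_def)
      have "Suc i \<le> d"
        using Suc n by simp
      then have "A v \<in> X (Suc (Suc i))" "v \<in> X (Suc (Suc i))"
        using X vX unfolding adapted_flag_def by blast+
      then have "?v \<in> X (Suc (Suc i))"
        by (intro subspace_diff[OF S] subspace_scale[OF S])
      with Yv have "?v \<in> ?L (Suc i)"
        using Suc n by simp
      then show ?thesis
        using L_W[of "Suc i"] Suc n by auto
    qed
    from invariant_under_shift[of _ v A, OF W vW this] show ?thesis .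
  qed
  have As_L: "As v \<in> W r" if i: "i < Suc d - r" and v: "v \<in> ?L i" for i v
  proof (rule invariant_under_shift[of _ v As "\<theta>s i", OF W])
    show "v \<in> W r"
      using L_W[OF i] v by blast
    let ?v = "As v - scale (\<theta>s i) v"
    have Xv: "?v \<in> X i"
      using X v i by (auto simp: adapted_flag_def)
    show "?v \<in> W r"
    proof (cases i)
      case 0
      then show ?thesis
        using Xv X subspace_0[OF W] by (simp add: adapted_flag_def)
    next
      case (Suc k)
      have idx: "Suc (Suc d - (i + r)) = Suc d - (k + r)"
        using Suc i by simp
      have S: "subspace (Y (Suc d - (k + r)))"
        using Y by (auto simp: adapted_flag_def)
      have "Suc d - (i + r) \<le> d"
        using Suc by simp
      then have "As v \<in> Y (Suc d - (k + r))" "v \<in> Y (Suc d - (k + r))"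
        using Y v unfolding idx[symmetric] adapted_flag_def by blast+
      then have "?v \<in> Y (Suc d - (k + r))"
        by (intro subspace_diff[OF S] subspace_scale[OF S])
      with Xv have "?v \<in> ?L k"
        using Suc by simp
      then show ?thesis
        using L_W[of k] Suc i by auto
    qed
  qed
  show "A ` W r \<subseteq> W r"
    using linear_image_set_sum[OF lin(1) _ W, of "{..<Suc d - r}" ?L] A_L
    by (auto simp: W_def)
  show "As ` W r \<subseteq> W r"
    using linear_image_set_sum[OF lin(2) _ W, of "{..<Suc d - r}" ?L] As_L
    by (auto simp: W_def)
qed

text \<open>By irreducibility each ladder sum is \<open>{0}\<close> or everything. For \<open>r = 1\<close> it lies in the proper
  subspace \<open>Y d\<close>, so it vanishes, which makes the two flags opposite. For \<open>r = 0\<close> it contains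
  \<open>X (Suc 0) \<noteq> {0}\<close>, so the intersections \<open>U i\<close> span. Together these determine the partial sums:
  in a vector of \<open>X i\<close>, the components in \<open>U k\<close> with \<open>k \<ge> i\<close> drop out one by one from the top,
  since they lie in \<open>X k \<inter> Y (Suc d - k)\<close>.\<close>

lemma split_decomposition:
  assumes X: "adapted_flag scale As A d \<theta>s X" and Y: "adapted_flag scale A As d \<theta> Y"
    and lin: "Vector_Spaces.linear scale scale A" "Vector_Spaces.linear scale scale As"
    and irreducible: "\<forall>W. subspace W \<and> A ` W \<subseteq> W \<and> As ` W \<subseteq> W \<longrightarrow> W = {0} \<or> W = UNIV"
  defines "U \<equiv> \<lambda>i. X (Suc i) \<inter> Y (Suc d - i)"
  shows "\<And>i. i \<le> d \<Longrightarrow> subspace (U i)"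
    and "\<And>i. i \<le> d \<Longrightarrow> U i \<inter> (\<Sum>j<i. U j) = {0}"
    and "\<And>i. i \<le> Suc d \<Longrightarrow> (\<Sum>j<i. U j) = X i"
proof -
  define W where "W = (\<lambda>r. \<Sum>i<Suc d - r. X (Suc i) \<inter> Y (Suc d - (i + r)))"
  have W_cases: "W r = {0} \<or> W r = UNIV" for r
    using irreducible ladder_sum_invariant[OF X Y lin, of r] unfolding W_def by blast
  have subX: "subspace (X i)" and subY: "subspace (Y i)" if "i \<le> Suc d" for i
    using X Y that by (auto simp: adapted_flag_def)
  have opposite: "X i \<inter> Y (Suc d - i) = {0}" if i: "i \<le> Suc d" for i
  proof (cases i)
    case 0
    then show ?thesis
      using X Y by (auto simp: adapted_flag_def)
  next
    case (Suc k)
    show ?thesis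
    proof (cases "k = d")
      case True
      then show ?thesis
        using X Y Suc by (auto simp: adapted_flag_def)
    next
      case False
      have "Y (Suc d - (j + 1)) \<subseteq> Y d" for j
        by (rule adapted_flag_mono[OF Y]) auto
      then have "W 1 \<subseteq> Y d"
        unfolding W_def using subY[of d] by (intro set_sum_least) auto
      then have "W 1 = {0}"
        using W_cases[of 1] Y by (auto simp: adapted_flag_def)
      moreover have "X (Suc k) \<inter> Y (Suc d - (k + 1)) \<subseteq> W 1"
        unfolding W_def using False Suc i subX subY
        by (intro set_sum_upper) (auto intro!: subspace_inter)
      ultimately have "X i \<inter> Y (Suc d - i) \<subseteq> {0}"
        using Suc by simp
      then show ?thesis
        using subX[OF i] subY[of "Suc d - i"] by (auto intro: subspace_0)
    qed
  qed
  show subU: "subspace (U i)" if "i \<le> d" for i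
    unfolding U_def using subX subY that by (intro subspace_inter) auto
  have sum_le: "(\<Sum>j<i. U j) \<subseteq> X i" if i: "i \<le> Suc d" for i
  proof (rule set_sum_least)
    fix j assume "j \<in> {..<i}"
    then show "U j \<subseteq> X i"
      using adapted_flag_mono[OF X, of "Suc j" i] i by (auto simp: U_def)
  qed (use subX i in auto)
  have W0: "W 0 = (\<Sum>j<Suc d. U j)"
    by (simp add: W_def U_def del: sum.lessThan_Suc)
  have "U 0 \<subseteq> W 0"
    unfolding W0 using subU by (intro set_sum_upper) auto
  moreover have "U 0 \<noteq> {0}"
    using X Y by (simp add: U_def adapted_flag_def)
  ultimately have "W 0 \<noteq> {0}"
    using subspace_0[OF subU[of 0]] by auto
  with W_cases W0 have spans: "(\<Sum>j<Suc d. U j) = UNIV"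
    by metis
  show sum_eq: "(\<Sum>j<i. U j) = X i" if i: "i \<le> Suc d" for i
  proof (rule equalityI[OF sum_le[OF i]])
    show "X i \<subseteq> (\<Sum>j<i. U j)"
    proof (rule inc_induct[where P = "\<lambda>k. X i \<subseteq> (\<Sum>j<k. U j)", OF i])
      show "X i \<subseteq> (\<Sum>j<Suc d. U j)"
        unfolding spans by simp
    next
      fix k assume k: "i \<le> k" "k < Suc d" and IH: "X i \<subseteq> (\<Sum>j<Suc k. U j)"
      show "X i \<subseteq> (\<Sum>j<k. U j)"
      proof
        fix v assume v: "v \<in> X i"
        then have "v \<in> (\<Sum>j<k. U j) + U k"
          using IH by auto
        then obtain w u where wu: "v = w + u" "w \<in> (\<Sum>j<k. U j)" "u \<in> U k"
          by (elim set_plus_elim)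
        have "v \<in> X k" "w \<in> X k"
          using adapted_flag_mono[OF X, of i k] sum_le[of k] v wu k by auto
        with wu(1) subspace_diff[OF subX[of k], of v w] k have "u \<in> X k"
          by simp
        with wu(3) opposite[of k] k have "u = 0"
          by (auto simp: U_def)
        with wu show "v \<in> (\<Sum>j<k. U j)" by simp
      qed
    qed
  qed
  show "U i \<inter> (\<Sum>j<i. U j) = {0}" if i: "i \<le> d" for i
  proof -
    have "U i \<inter> X i \<subseteq> {0}"
      using opposite[of i] i by (auto simp: U_def)
    then show ?thesis
      using sum_eq[of i] subU[of i] subX[of i] i by (auto intro: subspace_0)
  qed
qed

end


section \<open>The map between the two split decompositions\<close>

theorem lemma9p4:
  fixes scale :: "'k::field \<Rightarrow> 'v::ab_group_add \<Rightarrow> 'v"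
    and Basis :: "'v set"
    and d :: nat
    and A As :: "'v \<Rightarrow> 'v"
    and E Es :: "nat \<Rightarrow> 'v \<Rightarrow> 'v"
  assumes "finite_dimensional_vector_space scale Basis"
    and "vector_space.dim scale (UNIV :: 'v set) > 0"
    and "d \<ge> 1"
    and "tridiagonal_system scale d A E As Es"
  shows "\<forall>i\<le>d.
    split_Delta d E Es ` split_U d E Es i = split_U_down d E Es i \<and>
    (\<lambda>v. split_Delta d E Es v - v) ` split_U d E Es i \<subseteq> (\<Sum>j\<in>{..<i}. split_U d E Es j)"
proof -
  interpret finite_dimensional_vector_space scale Basis by fact
  let ?V = "\<lambda>i. range (E i)"
  have pair: "tridiagonal_pair scale A As"
    and std: "standard_ordering scale A As d ?V"
    and std_s: "standard_ordering scale As A d (\<lambda>i. range (Es i))"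
    using assms(4) by (auto simp: tridiagonal_system_def)
  have lin: "Vector_Spaces.linear scale scale A" "Vector_Spaces.linear scale scale As"
    and diag: "diagonalizable scale A" "diagonalizable scale As"
    and irreducible: "\<forall>W. subspace W \<and> A ` W \<subseteq> W \<and> As ` W \<subseteq> W \<longrightarrow> W = {0} \<or> W = UNIV"
    using pair by (auto simp: tridiagonal_pair_def)
  define X where "X = (\<lambda>i. \<Sum>h<i. range (Es h))"
  define Y where "Y = (\<lambda>i. \<Sum>h<i. ?V h)"
  define Z where "Z = (\<lambda>i. \<Sum>h<i. ?V (d - h))"
  obtain \<theta>s where X: "adapted_flag scale As A d \<theta>s X"
    using adapted_flag_standard_ordering[OF lin(2,1) diag(2) std_s] unfolding X_def by blast
  obtain \<theta> where Y: "adapted_flag scale A As d \<theta> Y"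
    using adapted_flag_standard_ordering[OF lin diag(1) std] unfolding Y_def by blast
  obtain \<theta>' where Z: "adapted_flag scale A As d \<theta>' Z"
    using adapted_flag_standard_ordering[OF lin diag(1) standard_ordering_reverse[OF std]]
    unfolding Z_def by blast
  have U: "split_U d E Es i = X (Suc i) \<inter> Z (Suc d - i)" if "i \<le> d" for i
  proof -
    have "(\<Sum>h\<in>{i..d}. ?V h) = Z (Suc d - i)"
      unfolding Z_def
      by (rule sum.reindex_bij_witness[where i = "\<lambda>h. d - h" and j = "\<lambda>h. d - h"])
        (use that in auto)
    then show ?thesis
      by (simp add: split_U_def X_def lessThan_Suc_atMost del: sum.lessThan_Suc)
  qed
  have D: "split_U_down d E Es i = X (Suc i) \<inter> Y (Suc d - i)" if "i \<le> d" for i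
    using that
    by (simp add: split_U_down_def X_def Y_def Suc_diff_le lessThan_Suc_atMost del: sum.lessThan_Suc)
  \<comment> \<open>Both decompositions use the same flag \<open>X\<close>; this is why their partial sums agree.\<close>
  note U_split = split_decomposition[OF X Z lin irreducible]
  note D_split = split_decomposition[OF X Y lin irreducible]
  have U_sum: "(\<Sum>j<i. split_U d E Es j) = X i" if "i \<le> Suc d" for i
  proof -
    have "(\<Sum>j<i. split_U d E Es j) = (\<Sum>j<i. X (Suc j) \<inter> Z (Suc d - j))"
      using that by (intro sum.cong) (auto simp: U)
    then show ?thesis
      using U_split(3)[OF that] by simp
  qed
  have D_sum: "(\<Sum>j<i. split_U_down d E Es j) = X i" if "i \<le> Suc d" for i
  proof -
    have "(\<Sum>j<i. split_U_down d E Es j) = (\<Sum>j<i. X (Suc j) \<inter> Y (Suc d - j))"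
      using that by (intro sum.cong) (auto simp: D)
    then show ?thesis
      using D_split(3)[OF that] by simp
  qed
  have U_sub: "subspace (split_U d E Es i)" and D_sub: "subspace (split_U_down d E Es i)"
    if "i \<le> d" for i
    using U_split(1)[OF that] D_split(1)[OF that] that by (simp_all add: U D)
  have U_tri: "split_U d E Es i \<inter> (\<Sum>j<i. split_U d E Es j) = {0}"
    and D_tri: "split_U_down d E Es i \<inter> (\<Sum>j<i. split_U_down d E Es j) = {0}" if "i \<le> d" for i
    using U_split(2)[OF that] D_split(2)[OF that] U_split(3)[of i] D_split(3)[of i]
      U_sum[of i] D_sum[of i] that by (simp_all add: U D)
  have Delta: "split_Delta d E Es = (\<lambda>v. \<Sum>h\<in>{..d}.
      projection_along (split_U_down d E Es h) (\<Sum>j\<in>{..d} - {h}. split_U_down d E Es j)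
        (projection_along (split_U d E Es h) (\<Sum>j\<in>{..d} - {h}. split_U d E Es j) v))"
    by (simp add: fun_eq_iff split_Delta_def split_F_def split_F_down_def)
  show ?thesis
    unfolding Delta
  proof (intro allI impI conjI)
    fix i assume i: "i \<le> d"
    have flag: "(\<Sum>j<k. split_U d E Es j) = (\<Sum>j<k. split_U_down d E Es j)" if "k \<le> Suc d" for k
      using U_sum[OF that] D_sum[OF that] by simp
    note main = sum_of_projections_between_decompositions[where U = "split_U d E Es"
        and D = "split_U_down d E Es" and d = d and i = i]
    show "(\<lambda>v. \<Sum>h\<in>{..d}.
        projection_along (split_U_down d E Es h) (\<Sum>j\<in>{..d} - {h}. split_U_down d E Es j)
          (projection_along (split_U d E Es h) (\<Sum>j\<in>{..d} - {h}. split_U d E Es j) v))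
        ` split_U d E Es i = split_U_down d E Es i"
      by (rule main(1)) (assumption | rule U_sub D_sub U_tri D_tri flag i)+
    show "(\<lambda>v. (\<Sum>h\<in>{..d}.
        projection_along (split_U_down d E Es h) (\<Sum>j\<in>{..d} - {h}. split_U_down d E Es j)
          (projection_along (split_U d E Es h) (\<Sum>j\<in>{..d} - {h}. split_U d E Es j) v)) - v)
        ` split_U d E Es i \<subseteq> (\<Sum>j<i. split_U d E Es j)"
      by (rule main(2)) (assumption | rule U_sub D_sub U_tri D_tri flag i)+
  qed
qed

end
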